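(* Let $l\ge 1$ and let $J$ be a block Jacobi matrix with $l\times l$ Jacobi parameters $(A_n)_{n\ge1}$, $(B_n)_{n\ge1}$. Assume that $J$ belongs to the Nevai class, i.e. $B_n\to \mathbf{0}$ and $A_nA_n^*\to\mathbf{1}$ as $n\to\infty$. If $J$ is of type $1$, of type $2$, or of type $3$, then $A_n\to\mathbf{1}$ as $n\to\infty$.
   Context: All matrices are $l\times l$ with complex entries; $\mathbf{1}$ and $\mathbf{0}$ denote the $l\times l$ identity and zero matrices; $T^*$ is the conjugate transpose; $T>0$ means that $T$ is Hermitian positive definite. A block Jacobi matrix is an infinite block tridiagonal matrix $$J=\begin{pmatrix} B_1&A_1&\mathbf{0}&\\ A_1^*&B_2&A_2&\ddots\\ \mathbf{0}&A_2^*&B_3&\ddots\\ &\ddots&\ddots&\ddots\end{pmatrix},$$ where $A_n,B_n$ $(n\ge1)$ are $l\times l$ matrices with every $A_n$ invertible. The sequences $(A_n)$, $(B_n)$ are called the Jacobi parameters of $J$. A block Jacobi matrix is of type $1$ if $A_n>0$ for all $n$; of type $2$ if $A_1A_2\cdots A_n>0$ for all $n$; and of type $3$ if every $A_n$ is lower triangular with strictly positive elements on the diagonal. *)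

theory Defs
  imports "HOL-Analysis.Analysis"
begin

definition conj_transpose :: "complex^'n^'m \<Rightarrow> complex^'m^'n" where
  "conj_transpose T = (\<chi> i j. cnj (T $ j $ i))"

definition hermitian :: "complex^'l^'l \<Rightarrow> bool" where
  "hermitian T \<longleftrightarrow> conj_transpose T = T"

(* For Hermitian T the form x* T x is real, so its real part is its value.
   The inner product of HOL-Analysis on complex vectors is the real one and is not used. *)
definition hermitian_pos_def :: "complex^'l^'l \<Rightarrow> bool" where
  "hermitian_pos_def T \<longleftrightarrow>
     hermitian T \<and> (\<forall>x. x \<noteq> 0 \<longrightarrow> 0 < Re (\<Sum>i\<in>UNIV. cnj (x $ i) * (T *v x) $ i))"

(* J is an infinite matrix of blocks, J i j being the block in row i and column j. Indices start
   at 1: the values of J, A and B at index 0 are irrelevant here and below. *)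
definition block_jacobi ::
  "(nat \<Rightarrow> nat \<Rightarrow> complex^'l^'l) \<Rightarrow> (nat \<Rightarrow> complex^'l^'l) \<Rightarrow> (nat \<Rightarrow> complex^'l^'l) \<Rightarrow> bool" where
  "block_jacobi J A B \<longleftrightarrow>
     (\<forall>n\<ge>1. invertible (A n)) \<and>
     (\<forall>i\<ge>1. \<forall>j\<ge>1. J i j =
        (if j = i then B i
         else if j = i + 1 then A i
         else if i = j + 1 then conj_transpose (A j)
         else 0))"

definition nevai_class :: "(nat \<Rightarrow> complex^'l^'l) \<Rightarrow> (nat \<Rightarrow> complex^'l^'l) \<Rightarrow> bool" where
  "nevai_class A B \<longleftrightarrow>
     B \<longlonglongrightarrow> 0 \<and> (\<lambda>n. A n ** conj_transpose (A n)) \<longlonglongrightarrow> mat 1"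

primrec ordered_prod :: "(nat \<Rightarrow> complex^'l^'l) \<Rightarrow> nat \<Rightarrow> complex^'l^'l" where
  "ordered_prod A 0 = mat 1"
| "ordered_prod A (Suc n) = ordered_prod A n ** A (Suc n)"

definition jacobi_type1 :: "(nat \<Rightarrow> complex^'l^'l) \<Rightarrow> bool" where
  "jacobi_type1 A \<longleftrightarrow> (\<forall>n\<ge>1. hermitian_pos_def (A n))"

definition jacobi_type2 :: "(nat \<Rightarrow> complex^'l^'l) \<Rightarrow> bool" where
  "jacobi_type2 A \<longleftrightarrow> (\<forall>n\<ge>1. hermitian_pos_def (ordered_prod A n))"

definition lower_triangular :: "complex^('l::{finite,linorder})^('l::{finite,linorder}) \<Rightarrow> bool" where
  "lower_triangular T \<longleftrightarrow> (\<forall>i j. i < j \<longrightarrow> T $ i $ j = 0)"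

definition jacobi_type3 :: "(nat \<Rightarrow> complex^('l::{finite,linorder})^('l::{finite,linorder})) \<Rightarrow> bool" where
  "jacobi_type3 A \<longleftrightarrow>
     (\<forall>n\<ge>1. lower_triangular (A n) \<and> (\<forall>i. A n $ i $ i \<in> \<real> \<and> 0 < Re (A n $ i $ i)))"

end

theory Submission
  imports Defs
begin

text \<open>
  The three types share one property: the diagonal sum dominates the geometric mean that the
  determinant prescribes,
  \<open>l \<cdot> \<bar>det A\<^sub>n\<bar>\<^bsup>1/l\<^esup> \<le> Re (tr A\<^sub>n)\<close>.
  This is the AM-GM inequality for the eigenvalues of \<open>A\<^sub>n\<close>, which are positive in each case, and
  it forces convergence because of the Frobenius norm expansion
  \<open>\<parallel>A - 1\<parallel>\<^sup>2 = tr (A A\<^sup>*) - 2 Re (tr A) + l\<close>: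
  if \<open>A\<^sub>n A\<^sub>n\<^sup>* \<rightarrow> 1\<close>, then \<open>tr (A\<^sub>n A\<^sub>n\<^sup>*) \<rightarrow> l\<close> and \<open>\<bar>det A\<^sub>n\<bar> \<rightarrow> 1\<close>, so the right-hand side is
  squeezed between \<open>0\<close> and a quantity with limit \<open>l - 2l + l = 0\<close>.

  For type 3 the trace inequality is AM-GM applied to the diagonal entries
  (\<open>trace_ge_of_lower_triangular\<close>). For types 1 and 2 one has \<open>P A\<^sub>n = Q\<close> with \<open>P\<close> and \<open>Q\<close>
  positive definite: \<open>P = 1\<close> for type 1 and \<open>P = A\<^sub>1 \<cdots> A\<^bsub>n-1\<^esub>\<close> for type 2. Here no spectral
  theory is invoked. Symmetric Gaussian elimination is a congruence of determinant 1 that makes a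
  positive definite matrix diagonal and does not increase its diagonal
  (\<open>pos_def_diagonalization\<close>). Eliminating first in \<open>P\<close>, then in the transformed \<open>Q\<close>, yields
  positive numbers whose product is \<open>det A\<^sub>n\<close> and whose sum is at most \<open>tr A\<^sub>n\<close>
  (\<open>trace_ge_of_pos_def_quotient\<close>).
\<close>

section \<open>Conjugate transposes and congruence\<close>

lemma conj_transpose_nth [simp]: "conj_transpose A $ i $ j = cnj (A $ j $ i)"
  by (simp add: conj_transpose_def)

lemma conj_transpose_mult:
  fixes A :: "complex^'n^'m" and B :: "complex^'k^'n"
  shows "conj_transpose (A ** B) = conj_transpose B ** conj_transpose A"
  by (simp add: vec_eq_iff matrix_matrix_mult_def mult.commute)

lemma conj_transpose_conj_transpose [simp]: "conj_transpose (conj_transpose A) = A"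
  by (simp add: vec_eq_iff)

lemma conj_transpose_mat_1 [simp]: "conj_transpose (mat 1) = mat 1"
  by (simp add: vec_eq_iff mat_def)

lemma det_conj_transpose: "det (conj_transpose A) = cnj (det A)"
proof -
  have "det (conj_transpose A) = det (transpose (conj_transpose A))"
    by simp
  also have "\<dots> = cnj (det A)"
    by (simp add: det_def transpose_def)
  finally show ?thesis .
qed

lemma sesquilinear_adjoint:
  fixes C :: "complex^'n^'m"
  shows "(\<Sum>i\<in>UNIV. cnj (x $ i) * (C *v y) $ i)
    = (\<Sum>j\<in>UNIV. cnj ((conj_transpose C *v x) $ j) * y $ j)"
proof -
  have "(\<Sum>i\<in>UNIV. cnj (x $ i) * (C *v y) $ i)
      = (\<Sum>i\<in>UNIV. \<Sum>j\<in>UNIV. cnj (x $ i) * (C $ i $ j * y $ j))"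
    by (simp add: matrix_vector_mult_def sum_distrib_left)
  also have "\<dots> = (\<Sum>j\<in>UNIV. \<Sum>i\<in>UNIV. cnj (x $ i) * (C $ i $ j * y $ j))"
    by (rule sum.swap)
  also have "\<dots> = (\<Sum>j\<in>UNIV. cnj ((conj_transpose C *v x) $ j) * y $ j)"
    by (simp add: matrix_vector_mult_def sum_distrib_left mult_ac)
  finally show ?thesis .
qed

text \<open>The quadratic form of \<open>C T C\<^sup>*\<close> at \<open>x\<close> is that of \<open>T\<close> at \<open>C\<^sup>* x\<close>, and \<open>C\<^sup>*\<close> is injective.\<close>

lemma hermitian_pos_def_congruence:
  fixes T C :: "complex^'l^'l"
  assumes T: "hermitian_pos_def T" and C: "det C \<noteq> 0"
  shows "hermitian_pos_def (C ** T ** conj_transpose C)"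
  unfolding hermitian_pos_def_def
proof (intro conjI allI impI)
  show "hermitian (C ** T ** conj_transpose C)"
    using T by (simp add: hermitian_pos_def_def hermitian_def conj_transpose_mult matrix_mul_assoc)
next
  fix x :: "complex^'l"
  assume "x \<noteq> 0"
  let ?y = "conj_transpose C *v x"
  have "invertible (conj_transpose C)"
    using C by (simp add: invertible_det_nz det_conj_transpose)
  then have "?y \<noteq> 0"
    using \<open>x \<noteq> 0\<close> by (metis invertible_left_inverse matrix_left_invertible_ker)
  then have "0 < Re (\<Sum>i\<in>UNIV. cnj (?y $ i) * (T *v ?y) $ i)"
    using T by (simp add: hermitian_pos_def_def)
  also have "(\<Sum>i\<in>UNIV. cnj (?y $ i) * (T *v ?y) $ i)
      = (\<Sum>i\<in>UNIV. cnj (x $ i) * (C *v (T *v ?y)) $ i)"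
    by (rule sesquilinear_adjoint[symmetric])
  also have "C *v (T *v ?y) = (C ** T ** conj_transpose C) *v x"
    by (simp add: matrix_vector_mul_assoc matrix_mul_assoc)
  finally show "0 < Re (\<Sum>i\<in>UNIV. cnj (x $ i) * ((C ** T ** conj_transpose C) *v x) $ i)" .
qed

lemma hermitian_pos_def_mat_1: "hermitian_pos_def (mat 1 :: complex^'l^'l)"
  unfolding hermitian_pos_def_def
proof (intro conjI allI impI)
  show "hermitian (mat 1 :: complex^'l^'l)"
    by (simp add: hermitian_def)
next
  fix x :: "complex^'l"
  assume "x \<noteq> 0"
  then obtain k where k: "x $ k \<noteq> 0"
    by (auto simp: vec_eq_iff)
  have "0 < (\<Sum>i\<in>UNIV. (cmod (x $ i))\<^sup>2)"
    by (rule sum_pos2[where i = k]) (use k in auto)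
  also have "\<dots> = Re (\<Sum>i\<in>UNIV. cnj (x $ i) * ((mat 1 :: complex^'l^'l) *v x) $ i)"
    by (simp add: cmod_def power2_eq_square)
  finally show "0 < Re (\<Sum>i\<in>UNIV. cnj (x $ i) * ((mat 1 :: complex^'l^'l) *v x) $ i)" .
qed

lemma hermitian_pos_def_nth:
  assumes "hermitian_pos_def T"
  shows "T $ j $ i = cnj (T $ i $ j)"
  using assms unfolding hermitian_pos_def_def hermitian_def by (metis conj_transpose_nth)

lemma hermitian_pos_def_diag:
  fixes T :: "complex^'l^'l"
  assumes T: "hermitian_pos_def T"
  shows "0 < Re (T $ k $ k)" and "T $ k $ k = complex_of_real (Re (T $ k $ k))"
proof -
  have "axis k (1::complex) \<noteq> 0"
    by simp
  then have "0 < Re (\<Sum>i\<in>UNIV. cnj (axis k (1::complex) $ i) * (T *v axis k 1) $ i)"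
    using T unfolding hermitian_pos_def_def by blast
  also have "(\<Sum>i\<in>UNIV. cnj (axis k (1::complex) $ i) * (T *v axis k 1) $ i)
      = (\<Sum>i\<in>UNIV. if i = k then T $ k $ k else 0)"
    by (rule sum.cong) (auto simp: axis_def matrix_vector_mult_def if_distrib cong: if_cong)
  finally show "0 < Re (T $ k $ k)"
    by simp
  show "T $ k $ k = complex_of_real (Re (T $ k $ k))"
    using hermitian_pos_def_nth[OF T, of k k] by (simp add: complex_eq_iff)
qed

section \<open>Determinants with a single nonvanishing term\<close>

text \<open>
  This covers both triangular matrices over an index type with any finite linear order and the
  elimination matrices below, which are not triangular for a prescribed order.
\<close>

lemma det_eq_prod_diagonal:
  fixes A :: "'a::comm_ring_1^'n^'n"
  assumes zero: "\<And>p. p permutes UNIV \<Longrightarrow> p \<noteq> id \<Longrightarrow> \<exists>i. A $ i $ p i = 0"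
  shows "det A = (\<Prod>i\<in>UNIV. A $ i $ i)"
proof -
  let ?t = "\<lambda>p. of_int (sign p) * (\<Prod>i\<in>UNIV. A $ i $ p i)"
  have "sum ?t {p. p permutes UNIV} = sum ?t {id}"
  proof (rule sum.mono_neutral_right)
    show "\<forall>p\<in>{p. p permutes UNIV} - {id}. ?t p = 0"
    proof
      fix p :: "'n \<Rightarrow> 'n"
      assume "p \<in> {p. p permutes UNIV} - {id}"
      then obtain i where "A $ i $ p i = 0"
        using zero by auto
      then have "(\<Prod>i\<in>UNIV. A $ i $ p i) = 0"
        by (intro prod_zero) auto
      then show "?t p = 0"
        by simp
    qed
  qed (auto simp: permutes_id finite_permutations)
  then show ?thesis
    by (simp add: det_def sign_id)
qed

lemma det_lower_triangular:
  fixes A :: "complex^('l::{finite,linorder})^('l::{finite,linorder})"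
  assumes "lower_triangular A"
  shows "det A = (\<Prod>i\<in>UNIV. A $ i $ i)"
proof (rule det_eq_prod_diagonal)
  fix p :: "'l \<Rightarrow> 'l"
  assume p: "p permutes UNIV" and "p \<noteq> id"
  let ?moved = "{i. p i \<noteq> i}"
  have "?moved \<noteq> {}"
    using \<open>p \<noteq> id\<close> by (auto simp: fun_eq_iff)
  \<comment> \<open>The least moved index moves up: its image is moved too, because \<open>p\<close> is injective.\<close>
  then have m: "Min ?moved \<in> ?moved"
    by (intro Min_in) auto
  then have "p (Min ?moved) \<in> ?moved"
    using permutes_inj[OF p] by (auto dest: injD)
  then have "Min ?moved \<le> p (Min ?moved)"
    by (intro Min_le) auto
  with m have "Min ?moved < p (Min ?moved)"
    by auto
  then show "\<exists>i. A $ i $ p i = 0"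
    using assms unfolding lower_triangular_def by blast
qed

section \<open>Symmetric Gaussian elimination\<close>

text \<open>
  Writing the matrix as the identity minus a matrix supported in column \<open>k\<close> lets the products
  below expand entrywise without a case distinction; the intended use has \<open>c k = 0\<close>, so that the
  pivot row survives.
\<close>

definition row_elimination :: "'l \<Rightarrow> ('l \<Rightarrow> complex) \<Rightarrow> complex^'l^'l" where
  "row_elimination k c = (\<chi> i j. (if j = i then 1 else 0) - (if j = k then c i else 0))"

lemma row_elimination_mult_nth:
  "(row_elimination k c ** M) $ i $ j = M $ i $ j - c i * M $ k $ j"
  by (simp add: matrix_matrix_mult_def row_elimination_def left_diff_distrib sum_subtractf
      if_distrib[of "\<lambda>x. x * _"] cong: if_cong)

lemma mult_conj_transpose_row_elimination_nth:
  "(M ** conj_transpose (row_elimination k c)) $ i $ j = M $ i $ j - M $ i $ k * cnj (c j)"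
  by (simp add: matrix_matrix_mult_def row_elimination_def right_diff_distrib sum_subtractf
      if_distrib[of "\<lambda>x. _ * x"] if_distrib[of cnj] cong: if_cong)

lemma det_row_elimination:
  fixes c :: "'l::finite \<Rightarrow> complex"
  assumes "c k = 0"
  shows "det (row_elimination k c) = 1"
proof -
  have "det (row_elimination k c) = (\<Prod>i\<in>UNIV. row_elimination k c $ i $ i)"
  proof (rule det_eq_prod_diagonal, rule ccontr)
    fix p :: "'l \<Rightarrow> 'l"
    assume p: "p permutes UNIV" and "p \<noteq> id" and "\<nexists>i. row_elimination k c $ i $ p i = 0"
    then have nz: "row_elimination k c $ i $ p i \<noteq> 0" for i
      by blast
    \<comment> \<open>Row \<open>k\<close> has its only entry at \<open>k\<close>, so column \<open>k\<close> is taken and every other row is left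
      with its diagonal entry.\<close>
    have pk: "p k = k"
      using nz[of k] assms by (auto simp: row_elimination_def split: if_splits)
    have "p i = i" for i
    proof (cases "p i = k")
      case True
      then show ?thesis
        using pk permutes_inj[OF p] by (metis injD)
    next
      case False
      then show ?thesis
        using nz[of i] by (auto simp: row_elimination_def split: if_splits)
    qed
    then show False
      using \<open>p \<noteq> id\<close> by auto
  qed
  also have "\<dots> = 1"
    using assms by (intro prod.neutral) (auto simp: row_elimination_def)
  finally show ?thesis .
qed

text \<open>
  Clearing row and column \<open>k\<close> with the pivot \<open>T\<^sub>k\<^sub>k > 0\<close> replaces \<open>T\<^sub>i\<^sub>j\<close> by the Schur complement
  \<open>T\<^sub>i\<^sub>j - T\<^sub>i\<^sub>k T\<^sub>k\<^sub>j / T\<^sub>k\<^sub>k\<close>. Rows that were already cleared have \<open>T\<^sub>i\<^sub>k = 0\<close> and stay unchanged, while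
  \<open>T\<^sub>i\<^sub>i\<close> loses \<open>\<bar>T\<^sub>i\<^sub>k\<bar>\<^sup>2 / T\<^sub>k\<^sub>k\<close>. The bound on the diagonal is Hadamard's inequality in the form
  needed later.
\<close>

lemma pos_def_diagonalization_on:
  fixes T :: "complex^'l^'l"
  assumes T: "hermitian_pos_def T" and "finite S"
  shows "\<exists>C. det C = 1
    \<and> (\<forall>i\<in>S. \<forall>j. j \<noteq> i \<longrightarrow> (C ** T ** conj_transpose C) $ i $ j = 0)
    \<and> (\<forall>i. Re ((C ** T ** conj_transpose C) $ i $ i) \<le> Re (T $ i $ i))"
  using \<open>finite S\<close>
proof induction
  case empty
  show ?case
    by (intro exI[of _ "mat 1"]) simp
next
  case (insert k S)
  then obtain C where C: "det C = 1"
    and off: "\<And>i j. i \<in> S \<Longrightarrow> j \<noteq> i \<Longrightarrow> (C ** T ** conj_transpose C) $ i $ j = 0"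
    and le: "\<And>i. Re ((C ** T ** conj_transpose C) $ i $ i) \<le> Re (T $ i $ i)"
    by blast
  define M where "M = C ** T ** conj_transpose C"
  have M: "hermitian_pos_def M"
    unfolding M_def using T C by (intro hermitian_pos_def_congruence) auto
  define r where "r = Re (M $ k $ k)"
  have Mkk: "M $ k $ k = complex_of_real r" and r: "r > 0"
    using hermitian_pos_def_diag[OF M, of k] by (simp_all add: r_def)
  define c where "c i = (if i = k then 0 else M $ i $ k / M $ k $ k)" for i
  define E where "E = row_elimination k c"
  define N where "N = E ** M ** conj_transpose E"
  have N: "N $ i $ j = (if i = k \<or> j = k then (if i = j then M $ k $ k else 0)
      else M $ i $ j - M $ i $ k * M $ k $ j / M $ k $ k)" for i j
  proof -
    have "N $ i $ j = M $ i $ j - c i * M $ k $ j - (M $ i $ k - c i * M $ k $ k) * cnj (c j)"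
      by (simp add: N_def E_def row_elimination_mult_nth mult_conj_transpose_row_elimination_nth)
    moreover have "M $ k $ j = cnj (M $ j $ k)"
      by (rule hermitian_pos_def_nth[OF M])
    ultimately show ?thesis
      using r by (auto simp: c_def Mkk)
  qed
  have eq: "(E ** C) ** T ** conj_transpose (E ** C) = N"
    by (simp add: N_def M_def conj_transpose_mult matrix_mul_assoc)
  have "det (E ** C) = 1"
    using C by (simp add: det_mul E_def det_row_elimination c_def)
  moreover have "N $ i $ j = 0" if "i \<in> insert k S" "j \<noteq> i" for i j
    using that off[of i j, folded M_def] off[of i k, folded M_def] by (auto simp: N)
  moreover have "Re (N $ i $ i) \<le> Re (T $ i $ i)" for i
  proof -
    have "Re (N $ i $ i) \<le> Re (M $ i $ i)"
    proof (cases "i = k")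
      case False
      have "M $ i $ k * M $ k $ i = complex_of_real ((cmod (M $ i $ k))\<^sup>2)"
        using hermitian_pos_def_nth[OF M, of k i] by (simp only: complex_norm_square)
      then have "N $ i $ i = M $ i $ i - complex_of_real ((cmod (M $ i $ k))\<^sup>2 / r)"
        using False by (simp add: N Mkk)
      then have "Re (N $ i $ i) = Re (M $ i $ i) - (cmod (M $ i $ k))\<^sup>2 / r"
        by (simp only: minus_complex.simps Re_complex_of_real)
      then show ?thesis
        using r by simp
    qed (simp add: N)
    then show ?thesis
      using le[of i] by (simp add: M_def)
  qed
  ultimately show ?case
    by (intro exI[of _ "E ** C"]) (auto simp: eq)
qed

lemma pos_def_diagonalization:
  fixes T :: "complex^'l^'l"
  assumes T: "hermitian_pos_def T"
  shows "\<exists>C. det C = 1 \<and> hermitian_pos_def (C ** T ** conj_transpose C)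
    \<and> (\<forall>i j. i \<noteq> j \<longrightarrow> (C ** T ** conj_transpose C) $ i $ j = 0)
    \<and> (\<forall>i. Re ((C ** T ** conj_transpose C) $ i $ i) \<le> Re (T $ i $ i))"
proof -
  obtain C where C: "det C = 1"
    and off: "\<forall>i\<in>UNIV. \<forall>j. j \<noteq> i \<longrightarrow> (C ** T ** conj_transpose C) $ i $ j = 0"
    and le: "\<forall>i. Re ((C ** T ** conj_transpose C) $ i $ i) \<le> Re (T $ i $ i)"
    using pos_def_diagonalization_on[OF T finite[of UNIV]] by blast
  have "hermitian_pos_def (C ** T ** conj_transpose C)"
    using C by (intro hermitian_pos_def_congruence[OF T]) simp
  then show ?thesis
    using C off le by (intro exI[of _ C]) auto
qed

section \<open>The trace dominates the determinant\<close>

lemma arith_geom_mean_UNIV: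
  fixes x :: "'l::finite \<Rightarrow> real"
  assumes "\<And>i. x i > 0"
  shows "real CARD('l) * (\<Prod>i\<in>UNIV. x i) powr (1 / real CARD('l)) \<le> (\<Sum>i\<in>UNIV. x i)"
proof -
  have "(\<Prod>i\<in>UNIV. x i) powr (1 / real CARD('l)) \<le> (\<Sum>i\<in>UNIV. x i / real CARD('l))"
    using assms by (intro arith_geom_mean) (auto intro: less_imp_le)
  also have "\<dots> = (\<Sum>i\<in>UNIV. x i) / real CARD('l)"
    by (simp add: sum_divide_distrib)
  finally show ?thesis
    by (simp add: field_simps)
qed

lemma trace_ge_of_lower_triangular:
  fixes A :: "complex^('l::{finite,linorder})^('l::{finite,linorder})"
  assumes low: "lower_triangular A"
    and diag: "\<And>i. A $ i $ i \<in> \<real> \<and> 0 < Re (A $ i $ i)"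
  shows "real CARD('l) * cmod (det A) powr (1 / real CARD('l)) \<le> Re (trace A)"
proof -
  have "cmod (A $ i $ i) = Re (A $ i $ i)" for i
    using diag[of i] by (auto elim!: Reals_cases)
  then have "cmod (det A) = (\<Prod>i\<in>UNIV. Re (A $ i $ i))"
    by (simp add: det_lower_triangular[OF low] flip: prod_norm)
  then show ?thesis
    using arith_geom_mean_UNIV[of "\<lambda>i. Re (A $ i $ i)"] diag by (simp add: trace_def)
qed

text \<open>
  If \<open>C P C\<^sup>* = D\<close> is diagonal and \<open>Q' = C Q C\<^sup>*\<close>, then \<open>Q' = D W\<close> where \<open>W\<close> is similar to \<open>A\<close>. Hence
  \<open>tr A\<close> is the sum of the quotients \<open>Q'\<^sub>i\<^sub>i / D\<^sub>i\<^sub>i\<close>. Diagonalizing \<open>Q'\<close> to \<open>R\<close> only lowers these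
  quotients, and the quotients \<open>R\<^sub>i\<^sub>i / D\<^sub>i\<^sub>i\<close> multiply up to \<open>det Q / det P = det A\<close>.
\<close>

lemma trace_ge_of_pos_def_quotient:
  fixes P Q A :: "complex^'l^'l"
  assumes P: "hermitian_pos_def P" and Q: "hermitian_pos_def Q" and PA: "P ** A = Q"
  shows "real CARD('l) * cmod (det A) powr (1 / real CARD('l)) \<le> Re (trace A)"
proof -
  obtain C where C: "det C = 1"
    and D: "hermitian_pos_def (C ** P ** conj_transpose C)"
    and Doff: "\<And>i j. i \<noteq> j \<Longrightarrow> (C ** P ** conj_transpose C) $ i $ j = 0"
    using pos_def_diagonalization[OF P] by blast
  define U where "U = conj_transpose C"
  define D where "D = C ** P ** U"
  define Q' where "Q' = C ** Q ** U"
  have Q': "hermitian_pos_def Q'"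
    unfolding Q'_def U_def using C by (intro hermitian_pos_def_congruence[OF Q]) simp
  obtain E where E: "det E = 1"
    and R: "hermitian_pos_def (E ** Q' ** conj_transpose E)"
    and Roff: "\<And>i j. i \<noteq> j \<Longrightarrow> (E ** Q' ** conj_transpose E) $ i $ j = 0"
    and Rle: "\<And>i. Re ((E ** Q' ** conj_transpose E) $ i $ i) \<le> Re (Q' $ i $ i)"
    using pos_def_diagonalization[OF Q'] by blast
  define R where "R = E ** Q' ** conj_transpose E"
  define d where "d i = Re (D $ i $ i)" for i
  define q where "q i = Re (R $ i $ i)" for i
  have d: "d i > 0" "D $ i $ i = complex_of_real (d i)" for i
    using hermitian_pos_def_diag[OF D, of i] by (simp_all add: d_def D_def U_def)
  have q: "q i > 0" "R $ i $ i = complex_of_real (q i)" for i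
    using hermitian_pos_def_diag[OF R, of i] by (simp_all add: q_def R_def)

  have "invertible U"
    using C by (simp add: invertible_det_nz U_def det_conj_transpose)
  then obtain V where V: "U ** V = mat 1"
    by (auto simp: invertible_def)
  define W where "W = V ** A ** U"
  have "D ** W = C ** P ** (U ** V) ** A ** U"
    by (simp add: D_def W_def matrix_mul_assoc)
  also have "\<dots> = Q'"
    by (simp add: V Q'_def matrix_mul_assoc flip: PA)
  finally have DW: "D ** W = Q'" .
  have Q'_diag: "Q' $ i $ i = d i * W $ i $ i" for i
  proof -
    have "Q' $ i $ i = (\<Sum>k\<in>UNIV. if k = i then D $ i $ i * W $ i $ i else 0)"
      unfolding DW[symmetric] matrix_matrix_mult_def vec_lambda_beta
      using Doff by (intro sum.cong) (auto simp: D_def U_def)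
    then show ?thesis
      by (simp add: d)
  qed
  have "trace W = trace (U ** (V ** A))"
    unfolding W_def by (rule trace_mul_sym)
  then have trace: "trace A = trace W"
    by (simp add: V matrix_mul_assoc)
  have "(\<Sum>i\<in>UNIV. q i / d i) \<le> (\<Sum>i\<in>UNIV. Re (W $ i $ i))"
  proof (rule sum_mono)
    fix i
    have "q i \<le> Re (Q' $ i $ i)"
      using Rle[of i] by (simp add: q_def R_def)
    then show "q i / d i \<le> Re (W $ i $ i)"
      using d(1)[of i] by (simp add: Q'_diag field_simps)
  qed
  then have sum_le: "(\<Sum>i\<in>UNIV. q i / d i) \<le> Re (trace A)"
    by (simp add: trace) (simp add: trace_def)

  have detD: "det D = complex_of_real (\<Prod>i\<in>UNIV. d i)"
    using Doff by (subst det_diagonal) (auto simp: d D_def[symmetric] U_def[symmetric])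
  have "det R = complex_of_real (\<Prod>i\<in>UNIV. q i)"
    using Roff by (subst det_diagonal) (auto simp: q R_def[symmetric])
  moreover have "det R = det A * det D"
    using C E by (simp add: R_def Q'_def D_def U_def det_mul det_conj_transpose flip: PA)
  ultimately have prod_eq:
    "det A * complex_of_real (\<Prod>i\<in>UNIV. d i) = complex_of_real (\<Prod>i\<in>UNIV. q i)"
    by (simp add: detD)
  have dpos: "(\<Prod>i\<in>UNIV. d i) > 0" and qpos: "(\<Prod>i\<in>UNIV. q i) > 0"
    using d(1) q(1) by (simp_all add: prod_pos)
  have "cmod (det A) * (\<Prod>i\<in>UNIV. d i) = (\<Prod>i\<in>UNIV. q i)"
    using arg_cong[OF prod_eq, of cmod] dpos qpos
    by (simp only: norm_mult norm_of_real abs_of_pos)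
  then have "cmod (det A) = (\<Prod>i\<in>UNIV. q i) / (\<Prod>i\<in>UNIV. d i)"
    using dpos by (metis less_irrefl nonzero_eq_divide_eq)
  then have "cmod (det A) = (\<Prod>i\<in>UNIV. q i / d i)"
    by (simp add: prod_dividef)
  then show ?thesis
    using arith_geom_mean_UNIV[of "\<lambda>i. q i / d i"] sum_le d(1) q(1) by simp
qed

section \<open>Convergence\<close>

lemma norm_diff_mat_1_sq:
  fixes A :: "complex^'l^'l"
  shows "(norm (A - mat 1))\<^sup>2
    = Re (trace (A ** conj_transpose A)) - 2 * Re (trace A) + real CARD('l)"
proof -
  have "(norm (A - mat 1))\<^sup>2 = (\<Sum>i\<in>UNIV. \<Sum>j\<in>UNIV. (cmod (A $ i $ j - mat 1 $ i $ j))\<^sup>2)"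
    by (simp add: norm_vec_def L2_set_def sum_nonneg)
  also have "\<dots> = (\<Sum>i\<in>UNIV. \<Sum>j\<in>UNIV. (cmod (A $ i $ j))\<^sup>2
      + (if j = i then 1 - 2 * Re (A $ i $ i) else 0))"
    by (intro sum.cong refl) (auto simp: mat_def cmod_power2 power2_diff)
  also have "\<dots> = (\<Sum>i\<in>UNIV. \<Sum>j\<in>UNIV. (cmod (A $ i $ j))\<^sup>2)
      + (\<Sum>i\<in>UNIV. 1 - 2 * Re (A $ i $ i))"
    by (simp add: sum.distrib)
  also have "(\<Sum>i\<in>UNIV. \<Sum>j\<in>UNIV. (cmod (A $ i $ j))\<^sup>2) = Re (trace (A ** conj_transpose A))"
    by (simp add: trace_def matrix_matrix_mult_def cmod_power2) (simp add: power2_eq_square)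
  also have "(\<Sum>i\<in>UNIV. 1 - 2 * Re (A $ i $ i)) = real CARD('l) - 2 * Re (trace A)"
    by (simp add: trace_def sum_subtractf sum_distrib_left)
  finally show ?thesis
    by simp
qed

lemma tendsto_trace:
  fixes X :: "'b \<Rightarrow> complex^'l^'l"
  assumes "(X \<longlongrightarrow> L) F"
  shows "((\<lambda>n. trace (X n)) \<longlongrightarrow> trace L) F"
  unfolding trace_def by (intro tendsto_sum tendsto_vec_nth assms)

lemma tendsto_det:
  fixes X :: "'b \<Rightarrow> complex^'l^'l"
  assumes "(X \<longlongrightarrow> L) F"
  shows "((\<lambda>n. det (X n)) \<longlongrightarrow> det L) F"
  unfolding det_def by (intro tendsto_sum tendsto_mult tendsto_prod tendsto_const tendsto_vec_nth assms)

text \<open>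
  The trace inequality holds with equality at the identity, and the assumption on \<open>A A\<^sup>*\<close>
  controls both sides of it in the limit.
\<close>

lemma tendsto_mat_1_of_trace_ge:
  fixes A :: "nat \<Rightarrow> complex^'l^'l"
  assumes lim: "(\<lambda>n. A n ** conj_transpose (A n)) \<longlonglongrightarrow> mat 1"
    and trace: "\<And>n. n \<ge> 1 \<Longrightarrow>
      real CARD('l) * cmod (det (A n)) powr (1 / real CARD('l)) \<le> Re (trace (A n))"
  shows "A \<longlonglongrightarrow> mat 1"
proof -
  let ?l = "real CARD('l)"
  let ?t = "\<lambda>n. Re (trace (A n ** conj_transpose (A n)))"
  let ?g = "\<lambda>n. ?t n - 2 * (?l * cmod (det (A n)) powr (1 / ?l)) + ?l"
  have t: "?t \<longlonglongrightarrow> ?l"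
    using tendsto_Re[OF tendsto_trace[OF lim]] by (simp add: trace_I)
  have "cmod (det (A n ** conj_transpose (A n))) = (cmod (det (A n)))\<^sup>2" for n
    by (simp add: det_mul det_conj_transpose norm_mult power2_eq_square)
  then have "(\<lambda>n. (cmod (det (A n)))\<^sup>2) \<longlonglongrightarrow> 1"
    using tendsto_norm[OF tendsto_det[OF lim]] by simp
  then have "(\<lambda>n. cmod (det (A n))) \<longlonglongrightarrow> 1"
    using tendsto_real_sqrt[of "\<lambda>n. (cmod (det (A n)))\<^sup>2" 1] by simp
  then have "(\<lambda>n. cmod (det (A n)) powr (1 / ?l)) \<longlonglongrightarrow> 1 powr (1 / ?l)"
    by (intro tendsto_powr tendsto_const) simp_all
  then have "?g \<longlonglongrightarrow> ?l - 2 * (?l * 1 powr (1 / ?l)) + ?l"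
    by (intro tendsto_add tendsto_diff tendsto_mult tendsto_const t)
  then have g: "?g \<longlonglongrightarrow> 0"
    by simp
  have "(\<lambda>n. (norm (A n - mat 1))\<^sup>2) \<longlonglongrightarrow> 0"
  proof (rule tendsto_sandwich[OF _ _ tendsto_const g])
    show "\<forall>\<^sub>F n in sequentially. (norm (A n - mat 1))\<^sup>2 \<le> ?g n"
      using eventually_ge_at_top[of 1]
    proof eventually_elim
      case (elim n)
      then show ?case
        using trace[of n] by (simp add: norm_diff_mat_1_sq)
    qed
  qed simp
  then have "(\<lambda>n. norm (A n - mat 1)) \<longlonglongrightarrow> 0"
    using tendsto_real_sqrt[of "\<lambda>n. (norm (A n - mat 1))\<^sup>2" 0] by simp
  then show ?thesis
    by (simp add: LIM_zero_iff tendsto_norm_zero_iff)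
qed

theorem theorem1:
  fixes J :: "nat \<Rightarrow> nat \<Rightarrow> complex^('l::{finite,linorder})^('l::{finite,linorder})"
    and A B :: "nat \<Rightarrow> complex^('l::{finite,linorder})^('l::{finite,linorder})"
  assumes "block_jacobi J A B"
    and "nevai_class A B"
    and "jacobi_type1 A \<or> jacobi_type2 A \<or> jacobi_type3 A"
  shows "A \<longlonglongrightarrow> mat 1"
proof (rule tendsto_mat_1_of_trace_ge)
  show "(\<lambda>n. A n ** conj_transpose (A n)) \<longlonglongrightarrow> mat 1"
    using assms(2) by (simp add: nevai_class_def)
next
  fix n :: nat
  assume n: "n \<ge> 1"
  from assms(3)
  show "real CARD('l) * cmod (det (A n)) powr (1 / real CARD('l)) \<le> Re (trace (A n))"
  proof (elim disjE)
    assume "jacobi_type1 A"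
    with n have "hermitian_pos_def (A n)"
      by (simp add: jacobi_type1_def)
    then show ?thesis
      by (rule trace_ge_of_pos_def_quotient[OF hermitian_pos_def_mat_1]) simp
  next
    assume type2: "jacobi_type2 A"
    obtain m where m: "n = Suc m"
      using n by (cases n) auto
    \<comment> \<open>The empty product, which occurs for \<open>n = 1\<close>, is the identity and so positive definite.\<close>
    have "hermitian_pos_def (ordered_prod A m)"
      using type2 by (cases "m = 0") (simp_all add: jacobi_type2_def hermitian_pos_def_mat_1)
    moreover have "hermitian_pos_def (ordered_prod A n)"
      using type2 n by (simp add: jacobi_type2_def)
    ultimately show ?thesis
      by (rule trace_ge_of_pos_def_quotient) (simp add: m)
  next
    assume "jacobi_type3 A"
    with n show ?thesis
      by (intro trace_ge_of_lower_triangular) (auto simp: jacobi_type3_def)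
  qed
qed

end
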